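(* Let $a<b$ be real numbers and let $\rho:[a,b]\to\mathbb{R}$ be a continuous function. If $\rho$ has an antiderivative on $[a,b]$, then the integral of $\rho$ over $[a,b]$ exists.
   Context: The integral is defined axiomatically: the integral of $\rho$ over $[a,b]$ exists if there is a function $I:[a,b]\times[a,b]\to\mathbb{R}$ satisfying (A) $I(x,y)+I(y,z)=I(x,z)$ for all $x,y,z\in[a,b]$, and (B) $I(x,x+h)=\rho(x)h+o(h)$ as $h\to0$ for all $x\in[a,b]$, i.e. $\lim_{h\to0}\frac{I(x,x+h)-\rho(x)h}{h}=0$, where $h\neq0$ ranges over values with $x+h\in[a,b]$ (one-sided limits at the endpoints). The number $I(a,b)$ is then called the integral of $\rho$ over $[a,b]$. An antiderivative of $\rho$ on $[a,b]$ is a function $R:[a,b]\to\mathbb{R}$ with $R'(x)=\rho(x)$ for all $x\in[a,b]$ (one-sided derivatives at the endpoints). *)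

theory Defs
  imports "HOL-Analysis.Analysis"
begin

text \<open>
  Functions on \<open>[a, b]\<close> and \<open>[a, b] \<times> [a, b]\<close> are represented by total functions on the reals;
  all conditions below only involve their values on \<open>[a, b]\<close>.  The filter \<open>at 0 within S\<close>
  excludes \<open>h = 0\<close>, and the limit is one-sided when \<open>x\<close> is an endpoint.
\<close>

definition axiomatic_integral_function ::
  "(real \<Rightarrow> real) \<Rightarrow> real \<Rightarrow> real \<Rightarrow> (real \<Rightarrow> real \<Rightarrow> real) \<Rightarrow> bool" where
  "axiomatic_integral_function \<rho> a b I \<longleftrightarrow>
     (\<forall>x\<in>{a..b}. \<forall>y\<in>{a..b}. \<forall>z\<in>{a..b}. I x y + I y z = I x z) \<and>
     (\<forall>x\<in>{a..b}.
        ((\<lambda>h. (I x (x + h) - \<rho> x * h) / h) \<longlongrightarrow> 0) (at 0 within {h. x + h \<in> {a..b}}))"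

definition axiomatic_integral_exists :: "(real \<Rightarrow> real) \<Rightarrow> real \<Rightarrow> real \<Rightarrow> bool" where
  "axiomatic_integral_exists \<rho> a b \<longleftrightarrow> (\<exists>I. axiomatic_integral_function \<rho> a b I)"

definition antiderivative_on :: "(real \<Rightarrow> real) \<Rightarrow> (real \<Rightarrow> real) \<Rightarrow> real \<Rightarrow> real \<Rightarrow> bool" where
  "antiderivative_on R \<rho> a b \<longleftrightarrow>
     (\<forall>x\<in>{a..b}. (R has_real_derivative \<rho> x) (at x within {a..b}))"

end

theory Submission
  imports Defs
begin

text \<open>For an antiderivative \<open>R\<close>, the witness is \<open>I x y = R y - R x\<close>.
  Condition (A) is telescoping, and (B) is differentiability of \<open>R\<close> at
  \<open>x\<close>, with the limit in \<open>y\<close> rewritten as a limit in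
  \<open>h = y - x\<close> by \<open>filterlim_plus_at_within_0\<close>.\<close>

text \<open>Translation is continuous, and the cancellation hypothesis keeps \<open>x + h\<close>
  away from \<open>x\<close> when \<open>h\<close> is nonzero, so the limit stays punctured.
  Restricting \<open>h\<close> to the shifted set covers one-sided limits at endpoints.\<close>

lemma filterlim_plus_at_within_0:
  fixes x :: "'a::topological_monoid_add"
  assumes "\<And>h. x + h = x \<Longrightarrow> h = 0"
  shows "filterlim (\<lambda>h. x + h) (at x within S) (at 0 within {h. x + h \<in> S})"
proof -
  have "((\<lambda>h. x + h) \<longlongrightarrow> x + 0) (at 0 within {h. x + h \<in> S})"
    by (intro tendsto_intros)
  then show ?thesis
    using assms by (auto simp: filterlim_at eventually_at_filter intro!: always_eventually)
qed

theorem corollary3p1: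
  fixes a b :: real and \<rho> :: "real \<Rightarrow> real"
  assumes "a < b"
    and "continuous_on {a..b} \<rho>"
    and "\<exists>R. antiderivative_on R \<rho> a b"
  shows "axiomatic_integral_exists \<rho> a b"
proof -
  obtain R where R: "\<And>x. x \<in> {a..b} \<Longrightarrow> (R has_real_derivative \<rho> x) (at x within {a..b})"
    using assms(3) unfolding antiderivative_on_def by blast
  have "((\<lambda>h. (R (x + h) - R x - \<rho> x * h) / h) \<longlongrightarrow> 0) (at 0 within {h. x + h \<in> {a..b}})"
    if "x \<in> {a..b}" for x
  proof -
    have "((\<lambda>y. (R y - R x) / (y - x)) \<longlongrightarrow> \<rho> x) (at x within {a..b})"
      using R[OF that] by (simp only: has_field_derivative_iff)
    then have "((\<lambda>h. (R (x + h) - R x) / (x + h - x)) \<longlongrightarrow> \<rho> x) (at 0 within {h. x + h \<in> {a..b}})"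
      by (rule filterlim_compose) (rule filterlim_plus_at_within_0, simp)
    then have "((\<lambda>h. (R (x + h) - R x) / h - \<rho> x) \<longlongrightarrow> 0) (at 0 within {h. x + h \<in> {a..b}})"
      by (simp add: LIM_zero)
    then show ?thesis
      \<comment> \<open>The two expressions agree only for nonzero \<open>h\<close>, where
        \<open>\<rho> x * h / h = \<rho> x\<close>; at \<open>h = 0\<close> division by zero gives
        0, but the punctured filter ignores that point.\<close>
      by (rule tendsto_cong[THEN iffD1, rotated])
        (simp add: eventually_at_filter diff_divide_distrib)
  qed
  then have "axiomatic_integral_function \<rho> a b (\<lambda>x y. R y - R x)"
    unfolding axiomatic_integral_function_def by simp
  then show ?thesis
    unfolding axiomatic_integral_exists_def by blast
qed

end
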